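(* Let $F$ be a field with $\operatorname{Char}(F)\neq 2$ and let $R$ be a simple associative unital $F$-algebra. Let $*$ be an involution on $R$ of the first kind with set of symmetric elements $S$, and assume $S\subsetneq R$. Also assume that $\dim_{Z(R)}R>4$. Then $S$ is a commutative set if and only if $Z(R)=S$.
   Context: $S=\{r\in R: r^*=r\}$. The involution $*$ is of the first kind if $Z(R)\subseteq S$, where $Z(R)$ is the center of $R$ (a field, since $R$ is simple; $\dim_{Z(R)}R$ may be infinite). A subset $A\subseteq R$ is a commutative set if $xy=yx$ for all $x,y\in A$. *)

theory Defs
  imports "HOL-Algebra.Algebra"
begin

text \<open>The library locale \<^locale>\<open>algebra\<close> requires the algebra itself to be commutative; this is
  the associative unital but not necessarily commutative version.\<close>

locale assoc_algebra = module R M + M: ring M for R (structure) and M (structure) +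
  assumes smult_mult_left:
      "\<lbrakk> a \<in> carrier R; x \<in> carrier M; y \<in> carrier M \<rbrakk> \<Longrightarrow>
        (a \<odot>\<^bsub>M\<^esub> x) \<otimes>\<^bsub>M\<^esub> y = a \<odot>\<^bsub>M\<^esub> (x \<otimes>\<^bsub>M\<^esub> y)"
    and smult_mult_right:
      "\<lbrakk> a \<in> carrier R; x \<in> carrier M; y \<in> carrier M \<rbrakk> \<Longrightarrow>
        x \<otimes>\<^bsub>M\<^esub> (a \<odot>\<^bsub>M\<^esub> y) = a \<odot>\<^bsub>M\<^esub> (x \<otimes>\<^bsub>M\<^esub> y)"

definition ring_char :: "('a, 'm) ring_scheme \<Rightarrow> nat" where
  "ring_char R =
    (if \<exists>n>0. add_pow R (n::nat) \<one>\<^bsub>R\<^esub> = \<zero>\<^bsub>R\<^esub>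
     then LEAST n. n > 0 \<and> add_pow R n \<one>\<^bsub>R\<^esub> = \<zero>\<^bsub>R\<^esub>
     else 0)"

locale simple_ring = ring R for R (structure) +
  assumes one_not_zero: "\<one> \<noteq> \<zero>"
    and trivial_ideals: "ideal I R \<Longrightarrow> I = {\<zero>} \<or> I = carrier R"

definition center :: "('a, 'm) ring_scheme \<Rightarrow> 'a set" where
  "center R = {z \<in> carrier R. \<forall>x \<in> carrier R. z \<otimes>\<^bsub>R\<^esub> x = x \<otimes>\<^bsub>R\<^esub> z}"

text \<open>Linearity over a base field is not required: for an involution of the first kind on an
  algebra it is automatic, because the image of the base field lies in the center.\<close>

locale ring_involution = ring R for R :: "('a, 'm) ring_scheme" (structure) and star :: "'a \<Rightarrow> 'a" +
  assumes star_closed: "x \<in> carrier R \<Longrightarrow> star x \<in> carrier R"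
    and star_add: "\<lbrakk> x \<in> carrier R; y \<in> carrier R \<rbrakk> \<Longrightarrow> star (x \<oplus> y) = star x \<oplus> star y"
    and star_mult: "\<lbrakk> x \<in> carrier R; y \<in> carrier R \<rbrakk> \<Longrightarrow> star (x \<otimes> y) = star y \<otimes> star x"
    and star_star: "x \<in> carrier R \<Longrightarrow> star (star x) = x"

definition symmetric_elements :: "('a, 'm) ring_scheme \<Rightarrow> ('a \<Rightarrow> 'a) \<Rightarrow> 'a set" where
  "symmetric_elements R star = {r \<in> carrier R. star r = r}"

definition first_kind :: "('a, 'm) ring_scheme \<Rightarrow> ('a \<Rightarrow> 'a) \<Rightarrow> bool" where
  "first_kind R star \<longleftrightarrow> center R \<subseteq> symmetric_elements R star"

definition commutative_set :: "('a, 'm) ring_scheme \<Rightarrow> 'a set \<Rightarrow> bool" where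
  "commutative_set R A \<longleftrightarrow> (\<forall>x\<in>A. \<forall>y\<in>A. x \<otimes>\<^bsub>R\<^esub> y = y \<otimes>\<^bsub>R\<^esub> x)"

text \<open>The dimension of \<open>R\<close> as a left vector space over \<open>K\<close> exceeds \<open>n\<close>. The library function
  \<^const>\<open>ring.dim\<close> is only meaningful in finite dimension; infinite dimension counts as greater
  than every \<open>n\<close>.\<close>

definition dim_greater :: "('a, 'm) ring_scheme \<Rightarrow> 'a set \<Rightarrow> nat \<Rightarrow> bool" where
  "dim_greater R K n \<longleftrightarrow>
    \<not> ring.finite_dimension R K (carrier R) \<or> ring.dim R K (carrier R) > n"

end

theory Submission
  imports Defs
begin

text \<open>If \<open>S\<close> is commutative, every \<open>s \<in> S\<close> is central, for the following reason. Consider the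
  inner derivation \<open>d x = s x - x s\<close>. It kills \<open>S\<close>, in particular \<open>x + x\<^sup>*\<close>, so \<open>d (x\<^sup>*) = - d x\<close>;
  since also \<open>(d x)\<^sup>* = - d (x\<^sup>*)\<close>, every value \<open>d x\<close> is symmetric, hence is killed by \<open>d\<close> again.
  Thus \<open>d \<circ> d = 0\<close>. Expanding \<open>d (d (x y)) = 0\<close> by the Leibniz rule leaves \<open>2 (d x) (d y) = 0\<close>,
  and 2 is invertible because the base field has characteristic different from 2. Replacing \<open>x\<close> by
  \<open>x z\<close> in \<open>(d x) (d y) = 0\<close> gives \<open>(d x) z (d y) = 0\<close> for all \<open>z\<close>, and a simple ring is prime,
  so \<open>d = 0\<close>. That \<open>Z(R) \<subseteq> S\<close> is the definition of the first kind, and the converse implication holds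
  because the center is commutative.\<close>

definition commutator :: "('a, 'm) ring_scheme \<Rightarrow> 'a \<Rightarrow> 'a \<Rightarrow> 'a" where
  "commutator R x y = x \<otimes>\<^bsub>R\<^esub> y \<ominus>\<^bsub>R\<^esub> y \<otimes>\<^bsub>R\<^esub> x"

context ring
begin

lemma commutator_closed [simp]:
  "\<lbrakk> s \<in> carrier R; x \<in> carrier R \<rbrakk> \<Longrightarrow> commutator R s x \<in> carrier R"
  by (simp add: commutator_def)

lemma commutator_eq_zero_iff:
  "\<lbrakk> s \<in> carrier R; x \<in> carrier R \<rbrakk> \<Longrightarrow> commutator R s x = \<zero> \<longleftrightarrow> s \<otimes> x = x \<otimes> s"
  by (simp add: commutator_def)

lemma commutator_add:
  "\<lbrakk> s \<in> carrier R; x \<in> carrier R; y \<in> carrier R \<rbrakk> \<Longrightarrow>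
    commutator R s (x \<oplus> y) = commutator R s x \<oplus> commutator R s y"
  by (simp add: commutator_def a_minus_def r_distr l_distr minus_add a_ac)

lemma commutator_mult:
  assumes "s \<in> carrier R" "x \<in> carrier R" "y \<in> carrier R"
  shows "commutator R s (x \<otimes> y) = commutator R s x \<otimes> y \<oplus> x \<otimes> commutator R s y"
proof -
  have "commutator R s x \<otimes> y = s \<otimes> x \<otimes> y \<ominus> x \<otimes> s \<otimes> y"
    using assms by (simp add: commutator_def a_minus_def l_distr l_minus)
  moreover have "x \<otimes> commutator R s y = x \<otimes> s \<otimes> y \<ominus> x \<otimes> y \<otimes> s"
    using assms by (simp add: commutator_def a_minus_def r_distr r_minus m_assoc)
  ultimately show ?thesis
    using assms by (simp add: commutator_def a_minus_def a_assoc r_neg1 m_assoc)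
qed

lemma mult_commutator_eq_zero:
  assumes two_torsion_free: "\<And>x. \<lbrakk> x \<in> carrier R; x \<oplus> x = \<zero> \<rbrakk> \<Longrightarrow> x = \<zero>"
    and s: "s \<in> carrier R"
    and square_zero: "\<And>x. x \<in> carrier R \<Longrightarrow> commutator R s (commutator R s x) = \<zero>"
    and x: "x \<in> carrier R" and y: "y \<in> carrier R"
  shows "commutator R s x \<otimes> commutator R s y = \<zero>"
proof (rule two_torsion_free)
  let ?d = "commutator R s"
  have "\<zero> = ?d (?d (x \<otimes> y))"
    using square_zero x y by simp
  also have "\<dots> = (?d (?d x) \<otimes> y \<oplus> ?d x \<otimes> ?d y) \<oplus> (?d x \<otimes> ?d y \<oplus> x \<otimes> ?d (?d y))"
    using s x y by (simp add: commutator_mult commutator_add)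
  also have "\<dots> = ?d x \<otimes> ?d y \<oplus> ?d x \<otimes> ?d y"
    using square_zero s x y by simp
  finally show "?d x \<otimes> ?d y \<oplus> ?d x \<otimes> ?d y = \<zero>" by simp
qed (use s x y in simp)

text \<open>The Leibniz rule for \<open>x z\<close> inserts an arbitrary factor \<open>z\<close> between the two commutators;
  this is the form to which primeness applies.\<close>

lemma commutator_mult_commutator_eq_zero:
  assumes two_torsion_free: "\<And>x. \<lbrakk> x \<in> carrier R; x \<oplus> x = \<zero> \<rbrakk> \<Longrightarrow> x = \<zero>"
    and s: "s \<in> carrier R"
    and square_zero: "\<And>x. x \<in> carrier R \<Longrightarrow> commutator R s (commutator R s x) = \<zero>"
    and x: "x \<in> carrier R" and y: "y \<in> carrier R" and z: "z \<in> carrier R"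
  shows "commutator R s x \<otimes> z \<otimes> commutator R s y = \<zero>"
proof -
  let ?d = "commutator R s"
  have prod: "?d u \<otimes> ?d v = \<zero>" if "u \<in> carrier R" "v \<in> carrier R" for u v
    using mult_commutator_eq_zero two_torsion_free s square_zero that by blast
  have "\<zero> = ?d (x \<otimes> z) \<otimes> ?d y"
    using prod x y z by simp
  also have "\<dots> = ?d x \<otimes> z \<otimes> ?d y \<oplus> x \<otimes> (?d z \<otimes> ?d y)"
    using s x y z by (simp add: commutator_mult l_distr m_assoc)
  also have "\<dots> = ?d x \<otimes> z \<otimes> ?d y"
    using prod s x y z by simp
  finally show ?thesis by simp
qed

end

text \<open>A simple ring is prime: the elements \<open>x\<close> with \<open>a R x = 0\<close> form a two-sided ideal. If it is
  zero then \<open>b = 0\<close>, and if it is everything then it contains 1, so that \<open>a = 0\<close>.\<close>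

lemma (in simple_ring) prime:
  assumes a: "a \<in> carrier R" and b: "b \<in> carrier R"
    and annihilate: "\<And>r. r \<in> carrier R \<Longrightarrow> a \<otimes> r \<otimes> b = \<zero>"
  shows "a = \<zero> \<or> b = \<zero>"
proof -
  let ?I = "{x \<in> carrier R. \<forall>r \<in> carrier R. a \<otimes> r \<otimes> x = \<zero>}"
  have "ideal ?I R"
  proof (rule idealI)
    show "subgroup ?I (add_monoid R)"
    proof (rule group.subgroupI)
      show "group (add_monoid R)" by (rule add.is_group)
      show "?I \<noteq> {}" using a by (auto intro!: exI[of _ \<zero>])
      fix x assume "x \<in> ?I"
      then show "inv\<^bsub>add_monoid R\<^esub> x \<in> ?I"
        using a by (auto simp: r_minus simp flip: a_inv_def)
    qed (use a in \<open>auto simp: r_distr\<close>)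
  next
    fix x t assume "x \<in> ?I" and t: "t \<in> carrier R"
    then have x: "x \<in> carrier R" and ax: "\<And>r. r \<in> carrier R \<Longrightarrow> a \<otimes> r \<otimes> x = \<zero>" by auto
    have "a \<otimes> r \<otimes> (t \<otimes> x) = \<zero>" if "r \<in> carrier R" for r
      using ax[of "r \<otimes> t"] a x t that by (simp add: m_assoc)
    then show "t \<otimes> x \<in> ?I" using x t by simp
    have "a \<otimes> r \<otimes> (x \<otimes> t) = (a \<otimes> r \<otimes> x) \<otimes> t" if "r \<in> carrier R" for r
      using a x t that by (simp add: m_assoc)
    then show "x \<otimes> t \<in> ?I" using ax x t by simp
  qed (rule ring_axioms)
  then consider "?I = {\<zero>}" | "?I = carrier R" using trivial_ideals by blast
  then show ?thesis
  proof cases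
    case 1
    moreover have "b \<in> ?I" using b annihilate by simp
    ultimately show ?thesis by blast
  next
    case 2
    then have "\<one> \<in> ?I" by simp
    then have "a \<otimes> \<one> \<otimes> \<one> = \<zero>" by blast
    then show ?thesis using a by simp
  qed
qed

context ring_involution
begin

lemma star_minus:
  assumes "x \<in> carrier R" "y \<in> carrier R"
  shows "star (x \<ominus> y) = star x \<ominus> star y"
proof -
  have "star x = star ((x \<ominus> y) \<oplus> y)"
    using assms by (simp add: a_minus_def a_assoc l_neg)
  also have "\<dots> = star (x \<ominus> y) \<oplus> star y"
    using assms by (simp add: star_add)
  finally show ?thesis
    using assms by (simp add: star_closed a_minus_def a_assoc r_neg)
qed

text \<open>The derivation kills \<open>x + x\<^sup>*\<close>, and \<open>*\<close> reverses products; the two signs cancel.\<close>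

lemma commutator_symmetric:
  assumes comm: "commutative_set R (symmetric_elements R star)"
    and s: "s \<in> symmetric_elements R star" and x: "x \<in> carrier R"
  shows "commutator R s x \<in> symmetric_elements R star"
proof -
  let ?d = "commutator R s"
  have sR: "s \<in> carrier R" and ss: "star s = s"
    using s by (auto simp: symmetric_elements_def)
  have "x \<oplus> star x \<in> symmetric_elements R star"
    using x by (simp add: symmetric_elements_def star_add star_star star_closed a_comm)
  then have "?d (x \<oplus> star x) = \<zero>"
    using comm s sR x by (simp add: commutative_set_def commutator_eq_zero_iff star_closed)
  then have dsum: "?d x \<oplus> ?d (star x) = \<zero>"
    using sR x by (simp add: commutator_add star_closed)
  have "star (?d x) = star x \<otimes> s \<ominus> s \<otimes> star x"
    using sR ss x by (simp add: commutator_def star_minus star_mult)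
  also have "\<dots> = \<ominus> ?d (star x)"
    using sR star_closed[OF x] by (simp add: commutator_def a_minus_def minus_add a_comm)
  also have "\<dots> = ?d x"
    using dsum sR x by (simp add: minus_equality star_closed)
  finally show ?thesis
    using sR x by (simp add: symmetric_elements_def)
qed

theorem commutative_symmetric_subset_center:
  assumes simple: "simple_ring R"
    and two_torsion_free: "\<And>x. \<lbrakk> x \<in> carrier R; x \<oplus> x = \<zero> \<rbrakk> \<Longrightarrow> x = \<zero>"
    and comm: "commutative_set R (symmetric_elements R star)"
  shows "symmetric_elements R star \<subseteq> center R"
proof
  fix s assume s: "s \<in> symmetric_elements R star"
  then have sR: "s \<in> carrier R" by (simp add: symmetric_elements_def)
  have square_zero: "commutator R s (commutator R s x) = \<zero>" if x: "x \<in> carrier R" for x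
    using comm s commutator_symmetric[OF comm s x] sR x
    by (simp add: commutator_eq_zero_iff commutative_set_def)
  have "commutator R s x = \<zero>" if x: "x \<in> carrier R" for x
    using simple_ring.prime[OF simple, of "commutator R s x" "commutator R s x"] sR x
      commutator_mult_commutator_eq_zero[OF two_torsion_free sR square_zero x x]
    by simp
  then show "s \<in> center R"
    using sR by (simp add: center_def commutator_eq_zero_iff)
qed

end

lemma two_ne_zero_if_ring_char_ne_2:
  assumes "field F" and char: "ring_char F \<noteq> 2"
  shows "\<one>\<^bsub>F\<^esub> \<oplus>\<^bsub>F\<^esub> \<one>\<^bsub>F\<^esub> \<noteq> \<zero>\<^bsub>F\<^esub>"
proof
  interpret field F by fact
  assume two: "\<one>\<^bsub>F\<^esub> \<oplus>\<^bsub>F\<^esub> \<one>\<^bsub>F\<^esub> = \<zero>\<^bsub>F\<^esub>"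
  have pow2: "add_pow F (2::nat) \<one>\<^bsub>F\<^esub> = \<zero>\<^bsub>F\<^esub>"
    using two by (simp add: numeral_2_eq_2)
  have "(LEAST n::nat. n > 0 \<and> add_pow F n \<one>\<^bsub>F\<^esub> = \<zero>\<^bsub>F\<^esub>) = 2"
  proof (rule Least_equality)
    fix n :: nat assume n: "n > 0 \<and> add_pow F n \<one>\<^bsub>F\<^esub> = \<zero>\<^bsub>F\<^esub>"
    then have "n \<noteq> 1" by auto
    with n show "2 \<le> n" by simp
  qed (use pow2 in simp)
  then have "ring_char F = 2"
    unfolding ring_char_def using pow2 by (metis zero_less_numeral)
  with char show False by contradiction
qed

lemma (in assoc_algebra) two_torsion_free:
  assumes "field R" and char: "ring_char R \<noteq> 2"
    and x: "x \<in> carrier M" and xx: "x \<oplus>\<^bsub>M\<^esub> x = \<zero>\<^bsub>M\<^esub>"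
  shows "x = \<zero>\<^bsub>M\<^esub>"
proof -
  interpret field R by fact
  let ?two = "\<one> \<oplus> \<one>"
  have "?two \<in> Units R"
    using two_ne_zero_if_ring_char_ne_2[OF \<open>field R\<close> char] by (simp add: field_Units)
  then have inv: "inv ?two \<in> carrier R" "inv ?two \<otimes> ?two = \<one>" by simp_all
  have "x = (inv ?two \<otimes> ?two) \<odot>\<^bsub>M\<^esub> x"
    using inv x by simp
  also have "\<dots> = inv ?two \<odot>\<^bsub>M\<^esub> (x \<oplus>\<^bsub>M\<^esub> x)"
    using inv(1) x
    by (simp only: smult_assoc1[of "inv ?two" ?two x] smult_l_distr[of \<one> \<one> x] smult_one[OF x]
        R.one_closed R.add.m_closed)
  also have "\<dots> = \<zero>\<^bsub>M\<^esub>"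
    using inv(1) xx by simp
  finally show ?thesis .
qed

theorem corollary2p11:
  fixes F :: "('f, 'm) ring_scheme"
    and R :: "('f, 'a, 'n) module_scheme"
    and star :: "'a \<Rightarrow> 'a"
  assumes "field F"
    and "ring_char F \<noteq> 2"
    and "assoc_algebra F R"
    and "simple_ring R"
    and "ring_involution R star"
    and "first_kind R star"
    and "symmetric_elements R star \<subset> carrier R"
    and "dim_greater R (center R) 4"
  shows "commutative_set R (symmetric_elements R star) \<longleftrightarrow> center R = symmetric_elements R star"
proof
  assume "commutative_set R (symmetric_elements R star)"
  then have "symmetric_elements R star \<subseteq> center R"
    using ring_involution.commutative_symmetric_subset_center[OF assms(5) assms(4)]
      assoc_algebra.two_torsion_free[OF assms(3) assms(1) assms(2)] by blast
  then show "center R = symmetric_elements R star"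
    using assms(6) by (auto simp: first_kind_def)
next
  assume "center R = symmetric_elements R star"
  moreover have "commutative_set R (center R)"
    unfolding commutative_set_def center_def by blast
  ultimately show "commutative_set R (symmetric_elements R star)" by simp
qed

end
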